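(* For all nonnegative integers $n$ and $\kappa$, the noncentral $\mathcal{R}(p,q)$-deformed Stirling numbers of the first kind $s(n,m;j)$ and of the second kind $S(n,m;j)$ satisfy the orthogonality relations $$\sum_{m=\kappa}^{n}s(n,m;j)\,S(m,\kappa;j)=\delta_{n,\kappa}\qquad\text{and}\qquad \sum_{m=\kappa}^{n}S(n,m;j)\,s(m,\kappa;j)=\delta_{n,\kappa},$$ where $\delta_{n,\kappa}$ is the Kronecker delta (and an empty sum is $0$).
   Context: Let $0<q<p\le 1$ be real numbers and let $\mathcal{R}$ be a meromorphic function of two variables. For real $u$ the $\mathcal{R}(p,q)$-deformed number is $[u]:=\mathcal{R}(p^u,q^u)$, and for integer $n\ge1$ the deformed factorial is $[u]_n:=\prod_{v=1}^{n}[u-v+1]$, $[u]_0:=1$. Standing assumption: there are positive real numbers $\epsilon_1=\Phi_1(p,q)$, $\epsilon_2=\Phi_2(p,q)$ such that $[u+v]=\epsilon_1^{v}[u]+\epsilon_2^{u}[v]$ for all real $u,v$. Fix real numbers $x$ and $j$ ($j$ is the noncentrality parameter). For $n\ge0$ put $$P_n(T):=\prod_{i=0}^{n-1}\left(T-\epsilon_1^{x-j-i}[j+i]\right),$$ a monic polynomial of degree $n$ in $T$; it satisfies $P_n([x])=\epsilon_2^{\binom n2+jn}[x-j]_n$. The noncentral deformed Stirling numbers of the first and second kind, $s(n,\kappa;j)=s_{\mathcal{R}(p,q)}(n,\kappa;j)$ and $S(n,\kappa;j)=S_{\mathcal{R}(p,q)}(n,\kappa;j)$ (which depend also on $x$ through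 $\epsilon_1^x$), are defined by the polynomial identities $$P_n(T)=\sum_{\kappa=0}^{n}s(n,\kappa;j)\,T^\kappa,\qquad T^n=\sum_{\kappa=0}^{n}S(n,\kappa;j)\,P_\kappa(T),$$ so that at $T=[x]$ they read $[x-j]_n=\epsilon_2^{-\binom n2-jn}\sum_{\kappa=0}^n s(n,\kappa;j)[x]^\kappa$ and $[x]^n=\sum_{\kappa=0}^n\epsilon_2^{\binom\kappa2+j\kappa}S(n,\kappa;j)[x-j]_\kappa$. *)

theory Defs
  imports "HOL-Analysis.Analysis" "HOL-Computational_Algebra.Polynomial"
begin

text \<open>Holomorphic functions of two complex variables: complex differentiability, i.e. the Frechet
  derivative exists and is complex linear.\<close>

definition holomorphic2_on :: "(complex \<times> complex \<Rightarrow> complex) \<Rightarrow> (complex \<times> complex) set \<Rightarrow> bool"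
  where "holomorphic2_on f U \<longleftrightarrow>
    (\<forall>z\<in>U. \<exists>f'. (f has_derivative f') (at z) \<and> (\<forall>c v w. f' (c * v, c * w) = c * f' (v, w)))"

text \<open>Locally a quotient of holomorphic functions whose denominator vanishes identically on no
  nonempty open set. As for \<open>meromorphic_on\<close> in one variable, the total function \<open>f\<close> may take
  arbitrary values on the zero set of the denominator.\<close>

definition meromorphic2_on :: "(complex \<times> complex \<Rightarrow> complex) \<Rightarrow> (complex \<times> complex) set \<Rightarrow> bool"
  where "meromorphic2_on f D \<longleftrightarrow> open D \<and>
    (\<forall>z\<in>D. \<exists>U g h. open U \<and> z \<in> U \<and> U \<subseteq> D \<and> holomorphic2_on g U \<and> holomorphic2_on h U \<and>
       (\<forall>V. open V \<and> V \<noteq> {} \<and> V \<subseteq> U \<longrightarrow> (\<exists>w\<in>V. h w \<noteq> 0)) \<and>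
       (\<forall>w\<in>U. h w \<noteq> 0 \<longrightarrow> f w = g w / h w))"

definition deformed_number ::
    "(complex \<times> complex \<Rightarrow> complex) \<Rightarrow> real \<Rightarrow> real \<Rightarrow> real \<Rightarrow> complex"
  where "deformed_number R p q u = R (of_real (p powr u), of_real (q powr u))"

definition deformed_factorial ::
    "(complex \<times> complex \<Rightarrow> complex) \<Rightarrow> real \<Rightarrow> real \<Rightarrow> real \<Rightarrow> nat \<Rightarrow> complex"
  where "deformed_factorial R p q u n = (\<Prod>v=1..n. deformed_number R p q (u - real v + 1))"

definition noncentral_poly ::
    "(complex \<times> complex \<Rightarrow> complex) \<Rightarrow> real \<Rightarrow> real \<Rightarrow> real \<Rightarrow> real \<Rightarrow> real \<Rightarrow> nat \<Rightarrow> complex poly"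
  where "noncentral_poly R p q \<epsilon>\<^sub>1 x j n =
    (\<Prod>i<n. [:- (of_real (\<epsilon>\<^sub>1 powr (x - j - real i)) * deformed_number R p q (j + real i)), 1:])"

text \<open>The Stirling numbers are the coefficients in the defining polynomial identities, extended by
  \<open>0\<close> to indices \<open>k > n\<close>. Existence and uniqueness of both expansions is proved below.\<close>

definition stirling1 ::
    "(complex \<times> complex \<Rightarrow> complex) \<Rightarrow> real \<Rightarrow> real \<Rightarrow> real \<Rightarrow> real \<Rightarrow> real \<Rightarrow> nat \<Rightarrow> nat \<Rightarrow> complex"
  where "stirling1 R p q \<epsilon>\<^sub>1 x j n =
    (THE c. (\<forall>k>n. c k = 0) \<and>
       noncentral_poly R p q \<epsilon>\<^sub>1 x j n = (\<Sum>k=0..n. smult (c k) (monom 1 k)))"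

definition stirling2 ::
    "(complex \<times> complex \<Rightarrow> complex) \<Rightarrow> real \<Rightarrow> real \<Rightarrow> real \<Rightarrow> real \<Rightarrow> real \<Rightarrow> nat \<Rightarrow> nat \<Rightarrow> complex"
  where "stirling2 R p q \<epsilon>\<^sub>1 x j n =
    (THE c. (\<forall>k>n. c k = 0) \<and>
       monom 1 n = (\<Sum>k=0..n. smult (c k) (noncentral_poly R p q \<epsilon>\<^sub>1 x j k)))"

lemma ex1_expansion:
  fixes B :: "nat \<Rightarrow> complex poly" and f :: "complex poly"
  assumes deg: "\<And>k. degree (B k) = k" and lc: "\<And>k. lead_coeff (B k) = 1"
    and f: "degree f \<le> n"
  shows "\<exists>!c. (\<forall>k>n. c k = 0) \<and> f = (\<Sum>k=0..n. smult (c k) (B k))"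
  using f
proof (induction n arbitrary: f)
  case 0
  then obtain a where a: "f = [:a:]" by (metis degree_eq_zeroE le_zero_eq)
  have B0: "B 0 = 1" using deg[of 0] lc[of 0] by (metis degree_eq_zeroE lead_coeff_pCons(2) one_pCons)
  show ?case
  proof (rule ex1I[of _ "\<lambda>k. if k = 0 then a else 0"])
    fix c assume "(\<forall>k>0. c k = 0) \<and> f = (\<Sum>k=0..0. smult (c k) (B k))"
    then show "c = (\<lambda>k. if k = 0 then a else 0)" by (auto simp: a B0 fun_eq_iff one_pCons)
  qed (simp add: a B0 one_pCons)
next
  case (Suc n)
  have top: "coeff (\<Sum>k=0..n. smult (c k) (B k)) (Suc n) = 0" for c
    by (simp add: coeff_sum coeff_eq_0 deg)
  have lcB: "coeff (B (Suc n)) (Suc n) = 1" using lc[of "Suc n"] deg[of "Suc n"] by simp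
  define b where "b = coeff f (Suc n)"
  define g where "g = f - smult b (B (Suc n))"
  have "degree g \<le> n"
  proof (rule degree_le, intro allI impI)
    fix i assume "n < i"
    then consider "i = Suc n" | "i > Suc n" by linarith
    then show "coeff g i = 0"
      by cases (use Suc.prems in \<open>auto simp: g_def b_def lcB coeff_eq_0 deg\<close>)
  qed
  from Suc.IH[OF this] obtain c where c: "\<forall>k>n. c k = 0" "g = (\<Sum>k=0..n. smult (c k) (B k))"
    and uni: "\<And>d. (\<forall>k>n. d k = 0) \<and> g = (\<Sum>k=0..n. smult (d k) (B k)) \<Longrightarrow> d = c" by blast
  show ?case
  proof (rule ex1I[of _ "c(Suc n := b)"])
    have "(\<Sum>k=0..n. smult ((c(Suc n := b)) k) (B k)) = g" unfolding c(2) by (rule sum.cong) auto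
    then show "(\<forall>k>Suc n. (c(Suc n := b)) k = 0) \<and> f = (\<Sum>k=0..Suc n. smult ((c(Suc n := b)) k) (B k))"
      using c(1) by (simp add: g_def)
  next
    fix d assume d: "(\<forall>k>Suc n. d k = 0) \<and> f = (\<Sum>k=0..Suc n. smult (d k) (B k))"
    then have f: "f = (\<Sum>k=0..n. smult (d k) (B k)) + smult (d (Suc n)) (B (Suc n))" by simp
    have db: "d (Suc n) = b" unfolding b_def f by (simp only: coeff_add top coeff_smult lcB) simp
    have "g = (\<Sum>k=0..n. smult ((d(Suc n := 0)) k) (B k))"
      unfolding g_def f db by (auto intro!: sum.cong)
    moreover have "\<forall>k>n. (d(Suc n := 0)) k = 0" using d by auto
    ultimately have "d(Suc n := 0) = c" using uni by blast
    then show "d = c(Suc n := b)" using db by auto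
  qed
qed

lemma degree_noncentral_poly: "degree (noncentral_poly R p q \<epsilon>\<^sub>1 x j n) = n"
  by (simp add: noncentral_poly_def degree_prod_eq_sum_degree)

lemma lead_coeff_noncentral_poly: "lead_coeff (noncentral_poly R p q \<epsilon>\<^sub>1 x j n) = 1"
  unfolding noncentral_poly_def lead_coeff_prod by simp

lemma stirling1_expansion:
  "noncentral_poly R p q \<epsilon>\<^sub>1 x j n = (\<Sum>k=0..n. smult (stirling1 R p q \<epsilon>\<^sub>1 x j n k) (monom 1 k))"
  using theI'[OF ex1_expansion[of "\<lambda>k. monom 1 k" "noncentral_poly R p q \<epsilon>\<^sub>1 x j n" n]]
  by (simp add: stirling1_def degree_noncentral_poly degree_monom_eq)

lemma stirling2_expansion:
  "monom 1 n = (\<Sum>k=0..n. smult (stirling2 R p q \<epsilon>\<^sub>1 x j n k) (noncentral_poly R p q \<epsilon>\<^sub>1 x j k))"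
  using theI'[OF ex1_expansion[of "noncentral_poly R p q \<epsilon>\<^sub>1 x j" "monom 1 n" n,
      OF degree_noncentral_poly lead_coeff_noncentral_poly degree_monom_le]]
  unfolding stirling2_def by blast

lemma poly_noncentral_poly_deformed_number:
  assumes pos: "\<epsilon>\<^sub>2 > 0"
    and add: "\<And>u v. deformed_number R p q (u + v) =
      of_real (\<epsilon>\<^sub>1 powr v) * deformed_number R p q u + of_real (\<epsilon>\<^sub>2 powr u) * deformed_number R p q v"
  shows "poly (noncentral_poly R p q \<epsilon>\<^sub>1 x j n) (deformed_number R p q x) =
    of_real (\<epsilon>\<^sub>2 powr (real (n choose 2) + j * real n)) * deformed_factorial R p q (x - j) n"
proof (induction n)
  case 0
  then show ?case using pos by (simp add: noncentral_poly_def deformed_factorial_def numeral_2_eq_2)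
next
  case (Suc n)
  have x: "deformed_number R p q x =
      of_real (\<epsilon>\<^sub>1 powr (x - j - real n)) * deformed_number R p q (j + real n) +
      of_real (\<epsilon>\<^sub>2 powr (j + real n)) * deformed_number R p q (x - j - real n)"
    using add[of "j + real n" "x - j - real n"] by simp
  have binom: "Suc n choose 2 = (n choose 2) + n"
    by (simp add: numeral_2_eq_2)
  have P: "noncentral_poly R p q \<epsilon>\<^sub>1 x j (Suc n) = noncentral_poly R p q \<epsilon>\<^sub>1 x j n *
      [:- (of_real (\<epsilon>\<^sub>1 powr (x - j - real n)) * deformed_number R p q (j + real n)), 1:]"
    by (simp add: noncentral_poly_def)
  have F: "deformed_factorial R p q (x - j) (Suc n) =
      deformed_factorial R p q (x - j) n * deformed_number R p q (x - j - real n)"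
  proof -
    have eq: "x - j - real (Suc n) + 1 = x - j - real n" by simp
    have "(\<Prod>v=1..Suc n. f v) = (\<Prod>v=1..n. f v) * f (Suc n)" for f :: "nat \<Rightarrow> complex"
      by simp
    then show ?thesis unfolding deformed_factorial_def by (simp only: eq)
  qed
  have pow: "\<epsilon>\<^sub>2 powr (real ((n choose 2) + n) + j * real (Suc n)) =
      \<epsilon>\<^sub>2 powr (real (n choose 2) + j * real n) * \<epsilon>\<^sub>2 powr (j + real n)"
    by (simp add: powr_add[symmetric] algebra_simps)
  have "poly [:- (of_real (\<epsilon>\<^sub>1 powr (x - j - real n)) * deformed_number R p q (j + real n)), 1:]
      (deformed_number R p q x) =
      of_real (\<epsilon>\<^sub>2 powr (j + real n)) * deformed_number R p q (x - j - real n)"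
    unfolding x by simp
  then show ?case
    unfolding P F binom pow poly_mult Suc.IH of_real_mult by (simp only: mult_ac)
qed

end

theory Submission
  imports Defs
begin

text \<open>The monomials and the polynomials \<open>noncentral_poly\<close> both contain exactly
  one monic polynomial of each degree, so both are bases of the polynomial ring, and the two kinds
  of Stirling numbers are the triangular matrices of the two base changes. Going from one basis to
  the other and back is the identity, so the matrices are mutually inverse. The lemma proves this
  for arbitrary families: substituting one expansion into the other writes \<open>A n\<close> in
  terms of the \<open>A k\<close>, and uniqueness (\<open>ex1_expansion\<close>) forces the
  coefficients to be Kronecker deltas.\<close>

lemma expansion_orthogonal:
  fixes A B :: "nat \<Rightarrow> complex poly" and a b :: "nat \<Rightarrow> nat \<Rightarrow> complex"
  assumes deg: "\<And>k. degree (A k) = k" and lc: "\<And>k. lead_coeff (A k) = 1"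
    and AB: "\<And>n. A n = (\<Sum>m=0..n. smult (a n m) (B m))"
    and BA: "\<And>n. B n = (\<Sum>k=0..n. smult (b n k) (A k))"
  shows "(\<Sum>m=k..n. a n m * b m k) = (if n = k then 1 else 0)"
proof -
  define c where "c k = (\<Sum>m=k..n. a n m * b m k)" for k
  \<comment> \<open>The range k \<le> m is written as a filtered part of \<open>{0..n}\<close>, the
    shape in which \<open>sum.swap_restrict\<close> can exchange the triangular double sum.\<close>
  have "A n = (\<Sum>m=0..n. \<Sum>k\<in>{k\<in>{0..n}. k \<le> m}. smult (a n m * b m k) (A k))"
  proof -
    have "smult (a n m) (B m) = (\<Sum>k\<in>{k\<in>{0..n}. k \<le> m}. smult (a n m * b m k) (A k))"
      if "m \<in> {0..n}" for m
    proof -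
      have "{k\<in>{0..n}. k \<le> m} = {0..m}" using that by auto
      \<comment> \<open>Scaling is multiplication by a constant polynomial, hence distributes over
        the sum.\<close>
      then show ?thesis by (simp add: BA sum_distrib_left[of "[:a n m:]", simplified])
    qed
    then show ?thesis by (subst AB) (rule sum.cong[OF refl])
  qed
  also have "\<dots> = (\<Sum>k=0..n. \<Sum>m\<in>{m\<in>{0..n}. k \<le> m}. smult (a n m * b m k) (A k))"
    by (rule sum.swap_restrict) simp_all
  also have "\<dots> = (\<Sum>k=0..n. smult (c k) (A k))"
  proof (rule sum.cong[OF refl])
    fix k
    have "{m\<in>{0..n}. k \<le> m} = {k..n}" by auto
    then show "(\<Sum>m\<in>{m\<in>{0..n}. k \<le> m}. smult (a n m * b m k) (A k)) = smult (c k) (A k)"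
      by (simp add: c_def smult_sum)
  qed
  finally have A_c: "A n = (\<Sum>k=0..n. smult (c k) (A k))" .
  let ?\<delta> = "\<lambda>k. if n = k then 1 else 0 :: complex"
  let ?Q = "\<lambda>d. (\<forall>k>n. d k = 0) \<and> A n = (\<Sum>k=0..n. smult (d k) (A k))"
  have ex1: "\<exists>!d. ?Q d"
    by (rule ex1_expansion[OF deg lc]) (simp add: deg)
  \<comment> \<open>For k > n the sum \<open>c k\<close> is empty, which gives the vanishing
    condition.\<close>
  have c: "?Q c"
    using A_c by (simp add: c_def)
  \<comment> \<open>The competing expansion is the trivial one, \<open>A n\<close> as
    itself.\<close>
  have \<delta>: "?Q ?\<delta>"
    by (simp add: if_distrib[of "\<lambda>r. smult r _"] cong: if_cong)
  have "c = ?\<delta>"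
    using the1_equality[of ?Q, OF ex1 c] the1_equality[of ?Q ?\<delta>, OF ex1 \<delta>] by (rule trans[OF sym])
  then show ?thesis by (simp add: c_def fun_eq_iff)
qed

theorem theorem3p34:
  fixes p q \<epsilon>\<^sub>1 \<epsilon>\<^sub>2 x j :: real
    and R :: "complex \<times> complex \<Rightarrow> complex" and D :: "(complex \<times> complex) set"
    and n \<kappa> :: nat
  assumes "0 < q" and "q < p" and "p \<le> 1"
    and "meromorphic2_on R D"
    and "\<And>u :: real. (complex_of_real (p powr u), complex_of_real (q powr u)) \<in> D"
    and "\<epsilon>\<^sub>1 > 0" and "\<epsilon>\<^sub>2 > 0"
    and "\<And>u v :: real. deformed_number R p q (u + v) =
           of_real (\<epsilon>\<^sub>1 powr v) * deformed_number R p q u +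
           of_real (\<epsilon>\<^sub>2 powr u) * deformed_number R p q v"
  shows "(\<Sum>m=\<kappa>..n. stirling1 R p q \<epsilon>\<^sub>1 x j n m * stirling2 R p q \<epsilon>\<^sub>1 x j m \<kappa>) =
           (if n = \<kappa> then 1 else 0) \<and>
         (\<Sum>m=\<kappa>..n. stirling2 R p q \<epsilon>\<^sub>1 x j n m * stirling1 R p q \<epsilon>\<^sub>1 x j m \<kappa>) =
           (if n = \<kappa> then 1 else 0)"
proof (intro conjI)
  let ?P = "noncentral_poly R p q \<epsilon>\<^sub>1 x j"
  show "(\<Sum>m=\<kappa>..n. stirling1 R p q \<epsilon>\<^sub>1 x j n m * stirling2 R p q \<epsilon>\<^sub>1 x j m \<kappa>) =
      (if n = \<kappa> then 1 else 0)"
    \<comment> \<open>The round trip starts and ends in the basis \<open>?P\<close>, passing through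
      the monomials.\<close>
    by (rule expansion_orthogonal[of ?P, OF degree_noncentral_poly lead_coeff_noncentral_poly
          stirling1_expansion stirling2_expansion])
  show "(\<Sum>m=\<kappa>..n. stirling2 R p q \<epsilon>\<^sub>1 x j n m * stirling1 R p q \<epsilon>\<^sub>1 x j m \<kappa>) =
      (if n = \<kappa> then 1 else 0)"
    \<comment> \<open>The same round trip with the bases exchanged; the remaining goal is that the
      coefficient 1 in \<open>degree_monom_eq\<close> is nonzero.\<close>
    by (rule expansion_orthogonal[of "monom 1", OF degree_monom_eq lead_coeff_monom
          stirling2_expansion stirling1_expansion]) simp
qed

end
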